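(* Let $\alpha\in(0,1]$. Then the lens map $\ell_\alpha:\mathbb{D}\to\mathbb{C}$ is a convex mapping with order $$\beta=\frac{\alpha\sin\left(\frac{\pi}{2}\alpha\right)}{1+\cos\left(\frac{\pi}{2}\alpha\right)},$$ that is, $$\inf_{z\in\mathbb{D}}\operatorname{Re}\left\{1+z\,\frac{\ell_\alpha''(z)}{\ell_\alpha'(z)}\right\}=\frac{\alpha\sin\left(\frac{\pi}{2}\alpha\right)}{1+\cos\left(\frac{\pi}{2}\alpha\right)}.$$
   Context: $\mathbb{D}=\{z\in\mathbb{C}:|z|<1\}$ is the open unit disc. For $\alpha\in(0,1]$, the lens map is $$\ell_\alpha(z)=\frac{\left(\frac{1+z}{1-z}\right)^{\alpha}-1}{\left(\frac{1+z}{1-z}\right)^{\alpha}+1},\qquad z\in\mathbb{D},$$ where the power is taken with the principal branch (the Möbius map $z\mapsto (1+z)/(1-z)$ sends $\mathbb{D}$ onto the right half plane). A locally univalent holomorphic function $f$ on $\mathbb{D}$ is a convex mapping (univalent with convex image) when $\operatorname{Re}\{1+z f''(z)/f'(z)\}>0$ on $\mathbb{D}$; its order of convexity is the exact value $\inf_{z\in\mathbb{D}}\operatorname{Re}\{1+z f''(z)/f'(z)\}$. These notions are applied to $\ell_\alpha$ without requiring the normalization $f'(0)=1$, since the expression is unchanged when $f$ is multiplied by a nonzero constant. *)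

theory Defs
  imports "HOL-Complex_Analysis.Complex_Analysis"
begin

abbreviation unit_disc :: "complex set" where
  "unit_disc \<equiv> ball 0 1"

text \<open>On the unit disc the base \<open>(1 + z) / (1 - z)\<close> has positive real part, so \<open>powr\<close>
  (which is \<open>exp (\<alpha> * Ln _)\<close> off zero) is the principal power.\<close>

definition lens_map :: "real \<Rightarrow> complex \<Rightarrow> complex" where
  "lens_map \<alpha> z =
     (((1 + z) / (1 - z)) powr of_real \<alpha> - 1) / (((1 + z) / (1 - z)) powr of_real \<alpha> + 1)"

definition convex_mapping :: "(complex \<Rightarrow> complex) \<Rightarrow> bool" where
  "convex_mapping f \<longleftrightarrow>
     f holomorphic_on unit_disc \<and> inj_on f unit_disc \<and> convex (f ` unit_disc)"

definition convexity_quantity :: "(complex \<Rightarrow> complex) \<Rightarrow> complex \<Rightarrow> real" where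
  "convexity_quantity f z = Re (1 + z * (deriv (deriv f) z / deriv f z))"

text \<open>The analytic description of convex mappings. Since division by zero yields zero,
  local univalence (a nonvanishing derivative) has to be required explicitly.\<close>

definition analytically_convex :: "(complex \<Rightarrow> complex) \<Rightarrow> bool" where
  "analytically_convex f \<longleftrightarrow>
     f holomorphic_on unit_disc \<and> (\<forall>z\<in>unit_disc. deriv f z \<noteq> 0) \<and>
     (\<forall>z\<in>unit_disc. convexity_quantity f z > 0)"

text \<open>An infimum of reals, meaningful only if the quantity is bounded below on the disc;
  \<open>analytically_convex f\<close> guarantees this.\<close>

definition convexity_order :: "(complex \<Rightarrow> complex) \<Rightarrow> real" where
  "convexity_order f = (INF z\<in>unit_disc. convexity_quantity f z)"

end

theory Submission imports Defs begin

text \<open>Put \<open>\<zeta> = Ln ((1 + z) / (1 - z))\<close>. Then \<open>z = tanh (\<zeta> / 2)\<close>, the disc becomes the strip \<open>\<bar>Im \<zeta>\<bar> < \<pi>/2\<close>,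
and the lens map becomes multiplication by \<open>\<alpha>\<close>: its value at \<open>z\<close> is \<open>tanh (\<alpha> \<zeta> / 2)\<close>. All claims
are read off in this coordinate.

\<^item> Univalence is clear, and the image corresponds to the narrower strip \<open>\<bar>Im \<eta>\<bar> < \<pi> \<alpha> / 2\<close>, so it
  is the intersection of two discs whose boundary circles pass through \<open>1\<close> and \<open>-1\<close>. Hence it is
  convex (\<open>lens_map_image\<close>).

\<^item> From \<open>dz / d\<zeta> = (1 - z\<^sup>2) / 2\<close> the convexity quantity is found to be the real part of
  \<open>cosh \<zeta> - \<alpha> sinh \<zeta> tanh (\<alpha> \<zeta> / 2)\<close> (\<open>convexity_quantity_lens_map\<close>). With \<open>\<zeta> = s + \<i> t\<close>, moving to the
  point \<open>\<i> t\<close> does not increase it (\<open>strip_quantity_ge_imaginary_axis\<close>), and on the imaginary axis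
  it equals \<open>cos t + \<alpha> sin t tan (\<alpha> t / 2)\<close>, which is nonincreasing for \<open>0 \<le> t \<le> \<pi>/2\<close>
  (\<open>imaginary_axis_ge_boundary_value\<close>). So the infimum is the limit at \<open>t = \<pi>/2\<close>, namely
  \<open>\<alpha> tan (\<pi> \<alpha> / 4)\<close>, which by the half-angle formula is the asserted value. It is positive, which
  is the analytic form of convexity.\<close>

section \<open>Comparison of trigonometric and hyperbolic functions at scaled arguments\<close>

text \<open>This is convexity of \<open>tan\<close> on \<open>[0, \<pi>/2)\<close> together with \<open>tan 0 = 0\<close>, obtained by comparing
derivatives: \<open>1 / cos\<^sup>2\<close> increases there.\<close>

lemma tan_mult_le:
  fixes a x :: real
  assumes "0 \<le> a" "a \<le> 1" "0 \<le> x" "x < pi / 2"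
  shows "tan (a * x) \<le> a * tan x"
proof -
  define f where "f y = a * tan y - tan (a * y)" for y :: real
  have "f 0 \<le> f x"
  proof (rule DERIV_nonneg_imp_nondecreasing[OF assms(3)])
    fix y assume y: "0 \<le> y" "y \<le> x"
    have ay: "0 \<le> a * y" "a * y \<le> y" using y assms by (auto simp: mult_left_le_one_le)
    have pos: "cos y > 0" "cos (a * y) > 0"
      using y ay assms by (auto intro!: cos_gt_zero_pi)
    have cos_le: "cos y \<le> cos (a * y)"
      using y ay assms by (intro cos_monotone_0_pi_le) auto
    have "(f has_real_derivative a * inverse ((cos y)\<^sup>2) - inverse ((cos (a * y))\<^sup>2) * a) (at y)"
      unfolding f_def using pos by (auto intro!: derivative_eq_intros)
    moreover have "inverse ((cos (a * y))\<^sup>2) \<le> inverse ((cos y)\<^sup>2)"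
      using pos cos_le by (intro le_imp_inverse_le power_mono) auto
    then have "a * inverse ((cos y)\<^sup>2) - inverse ((cos (a * y))\<^sup>2) * a \<ge> 0"
      using assms(1) by (simp add: mult.commute mult_left_mono)
    ultimately show "\<exists>d. (f has_real_derivative d) (at y) \<and> d \<ge> 0" by blast
  qed
  then show ?thesis by (simp add: f_def)
qed

text \<open>The hyperbolic counterpart, by the same comparison of derivatives.\<close>

lemma sinh_mult_le:
  fixes a x :: real
  assumes "0 \<le> a" "a \<le> 1" "0 \<le> x"
  shows "sinh (a * x) \<le> a * sinh x"
proof -
  define f where "f y = a * sinh y - sinh (a * y)" for y :: real
  have "f 0 \<le> f x"
  proof (rule DERIV_nonneg_imp_nondecreasing[OF assms(3)])
    fix y assume y: "0 \<le> y" "y \<le> x"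
    have ay: "0 \<le> a * y" "a * y \<le> y" using y assms by (auto simp: mult_left_le_one_le)
    have "(f has_real_derivative a * cosh y - cosh (a * y) * a) (at y)"
      unfolding f_def by (auto intro!: derivative_eq_intros)
    moreover have "cosh (a * y) \<le> cosh y"
      using y ay by (simp add: cosh_real_nonneg_le_iff)
    then have "a * cosh y - cosh (a * y) * a \<ge> 0"
      using assms(1) by (simp add: mult.commute mult_left_mono)
    ultimately show "\<exists>d. (f has_real_derivative d) (at y) \<and> d \<ge> 0" by blast
  qed
  then show ?thesis by (simp add: f_def)
qed

lemma tan_half_mult_one_plus_cos:
  fixes t :: real
  assumes "\<bar>t\<bar> < pi"
  shows "tan (t / 2) * (1 + cos t) = sin t" "(tan (t / 2))\<^sup>2 * (1 + cos t) = 1 - cos t"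
proof -
  have nz: "cos (t / 2) \<noteq> 0" using assms cos_gt_zero_pi[of "t / 2"] by (auto simp: abs_less_iff)
  have s: "sin t = 2 * sin (t / 2) * cos (t / 2)" using sin_double[of "t / 2"] by simp
  have c: "cos t = 2 * (cos (t / 2))\<^sup>2 - 1" using cos_double_cos[of "t / 2"] by simp
  show "tan (t / 2) * (1 + cos t) = sin t"
    using nz by (simp add: tan_def s c power2_eq_square)
  show "(tan (t / 2))\<^sup>2 * (1 + cos t) = 1 - cos t"
    using nz by (simp add: tan_def c power_divide sin_squared_eq)
qed

section \<open>The convexity quantity as a function on a strip\<close>

text \<open>The real part of \<open>cosh \<zeta> - a sinh \<zeta> tanh (a \<zeta> / 2)\<close> at \<open>\<zeta> = s + \<i> t\<close>, written out in real terms. It is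
the convexity quantity of \<open>lens_map a\<close> in the coordinate \<open>\<zeta> = Ln ((1 + z) / (1 - z))\<close>.\<close>

definition strip_quantity :: "real \<Rightarrow> real \<Rightarrow> real \<Rightarrow> real" where
  "strip_quantity a s t = cosh s * cos t -
     a * (sinh s * cos t * sinh (a * s) - cosh s * sin t * sin (a * t)) / (cosh (a * s) + cos (a * t))"

lemma strip_quantity_abs: "strip_quantity a s t = strip_quantity a \<bar>s\<bar> \<bar>t\<bar>"
  by (simp add: strip_quantity_def abs_if)

lemma strip_quantity_imaginary_axis:
  "strip_quantity a 0 t = cos t + a * sin t * tan (a * t / 2)"
proof -
  have "tan (a * t / 2) = sin (a * t) / (1 + cos (a * t))"
    by (simp add: tan_half add.commute)
  then show ?thesis by (simp add: strip_quantity_def)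
qed

text \<open>For fixed \<open>t\<close> the quantity is smallest at \<open>s = 0\<close>. After multiplication by the positive denominator
and passage to half arguments, the difference of the two sides is a sum of three terms, each
nonnegative for its own reason: \<open>a tanh (a s / 2) \<le> tanh (s / 2)\<close>; \<open>sinh (a s / 2) \<le> a sinh (s / 2)\<close>;
and an inequality in \<open>t\<close> alone, which follows from \<open>tan (a t / 2) \<le> a tan (t / 2)\<close> and
\<open>a\<^sup>2 (1 + cos t) \<le> 1 + cos (a t)\<close>. All three are equalities for \<open>a = 1\<close>, where the quantity is
constantly \<open>1\<close>, so there is no room for cruder estimates.\<close>

lemma strip_quantity_ge_imaginary_axis:
  assumes "0 < a" "a \<le> 1" "0 \<le> s" "0 \<le> t" "t < pi / 2"
  shows "strip_quantity a s t \<ge> cos t + a * sin t * tan (a * t / 2)"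
proof -
  define p where "p = sinh (s / 2)"
  define P where "P = cosh (s / 2)"
  define q where "q = sinh (a * s / 2)"
  define R where "R = cosh (a * s / 2)"
  define T where "T = tan (t / 2)"
  define \<tau> where "\<tau> = tan (a * t / 2)"
  define c where "c = cos (a * t)"
  define k where "k = cos t"
  have at: "0 \<le> a * t" "a * t \<le> t" using assms by (auto simp: mult_left_le_one_le)
  have at_pi: "a * t < pi" using at assms pi_gt_zero by linarith
  have k0: "k \<ge> 0" unfolding k_def using assms by (intro cos_ge_zero) auto
  have ck: "k \<le> c" unfolding k_def c_def using at assms by (intro cos_monotone_0_pi_le) auto
  have sin0: "sin t \<ge> 0" using assms by (intro sin_ge_zero) auto
  have a2: "a\<^sup>2 \<le> 1" using assms by (simp add: power_le_one)
  have \<tau>T: "\<tau> \<le> a * T"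
    using tan_mult_le[of a "t / 2"] assms by (simp add: \<tau>_def T_def)
  have \<tau>0: "\<tau> \<ge> 0"
    unfolding \<tau>_def using at at_pi assms by (intro tan_pos_pi2_le) auto
  have T_k: "T * (1 + k) = sin t"
    unfolding T_def k_def using assms by (intro tan_half_mult_one_plus_cos) auto
  have \<tau>_c: "\<tau> * (1 + c) = sin (a * t)" "\<tau>\<^sup>2 * (1 + c) = 1 - c"
    unfolding \<tau>_def c_def using at at_pi assms by (auto intro!: tan_half_mult_one_plus_cos)
  have p0: "p \<ge> 0" "P \<ge> 0" "q \<ge> 0" "R \<ge> 0"
    unfolding p_def P_def q_def R_def using assms by auto
  have q_le: "q \<le> a * p"
    using sinh_mult_le[of a "s / 2"] assms by (simp add: q_def p_def)
  have tanh_le: "a * P * q \<le> p * R"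
  proof -
    have "tanh (a * s / 2) \<le> tanh (s / 2)"
      using assms by (simp add: tanh_real_le_iff mult_left_le_one_le)
    then have "P * q \<le> p * R"
      unfolding tanh_def by (simp add: p_def P_def q_def R_def divide_simps mult.commute)
    moreover have "a * (P * q) \<le> P * q"
      using assms p0 by (intro mult_left_le_one_le) auto
    ultimately show ?thesis by (simp add: mult.assoc)
  qed
  have dbl: "cosh s = 1 + 2 * p\<^sup>2" "sinh s = 2 * p * P"
    "cosh (a * s) = 1 + 2 * q\<^sup>2" "sinh (a * s) = 2 * q * R"
    using cosh_double[of "s / 2"] sinh_double[of "s / 2"]
      cosh_double[of "a * s / 2"] sinh_double[of "a * s / 2"]
    by (simp_all add: p_def P_def q_def R_def cosh_square_eq)
  have R2: "R\<^sup>2 = 1 + q\<^sup>2" by (simp add: R_def q_def cosh_square_eq)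
  define D where "D = 1 + 2 * q\<^sup>2 + c"
  have Dpos: "D > 0" using k0 ck zero_le_power2[of q] unfolding D_def by linarith
  \<comment> \<open>The part of the inequality that involves \<open>t\<close> only; it is the coefficient of \<open>2 p\<^sup>2\<close> below.\<close>
  have key: "0 \<le> a * sin t * \<tau> * (1 + c - a\<^sup>2) - k * (1 - c)"
  proof -
    have "\<tau> * (1 + k) \<le> a * sin t"
      using mult_right_mono[OF \<tau>T, of "1 + k"] k0 T_k by (simp add: mult.assoc)
    then have "\<tau> * (1 + k) * (\<tau> * (1 + c - a\<^sup>2)) \<le> a * sin t * (\<tau> * (1 + c - a\<^sup>2))"
      using \<tau>0 a2 k0 ck by (intro mult_right_mono mult_nonneg_nonneg) auto
    moreover have "k * (1 - c) \<le> \<tau> * (1 + k) * (\<tau> * (1 + c - a\<^sup>2))"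
    proof -
      have "a\<^sup>2 * (1 + k) \<le> 1 + k"
        using a2 k0 by (intro mult_left_le_one_le) auto
      then have "a\<^sup>2 * (1 + k) \<le> 1 + c" using ck by simp
      then have "0 \<le> \<tau>\<^sup>2 * (1 + c - a\<^sup>2 * (1 + k))" by simp
      also have "\<dots> = \<tau> * (1 + k) * (\<tau> * (1 + c - a\<^sup>2)) - k * (\<tau>\<^sup>2 * (1 + c))" by algebra
      finally show ?thesis unfolding \<tau>_c by simp
    qed
    ultimately show ?thesis by (simp add: mult.assoc)
  qed
  \<comment> \<open>The three terms whose sum is the difference times the denominator \<open>D\<close>.\<close>
  have "0 \<le> 4 * k * p * R * (p * R - a * P * q)"
    using k0 p0 tanh_le by (intro mult_nonneg_nonneg) auto
  moreover have "0 \<le> 2 * p\<^sup>2 * (a * sin t * \<tau> * (1 + c - a\<^sup>2) - k * (1 - c))"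
    using key by (intro mult_nonneg_nonneg) auto
  moreover have "0 \<le> 2 * (a * sin t * \<tau>) * ((a * p)\<^sup>2 - q\<^sup>2)"
    using q_le p0 assms sin0 \<tau>0 by (intro mult_nonneg_nonneg) (auto intro!: power_mono)
  ultimately have "0 \<le> 4 * k * p * R * (p * R - a * P * q)
      + 2 * p\<^sup>2 * (a * sin t * \<tau> * (1 + c - a\<^sup>2) - k * (1 - c))
      + 2 * (a * sin t * \<tau>) * ((a * p)\<^sup>2 - q\<^sup>2)" by linarith
  also have "\<dots> = (1 + 2 * p\<^sup>2) * k * D
      - a * (2 * p * P * k * (2 * q * R) - (1 + 2 * p\<^sup>2) * sin t * (\<tau> * (1 + c)))
      - (k + a * sin t * \<tau>) * D"
    using R2 unfolding D_def by algebra
  also have "\<dots> = (strip_quantity a s t - (k + a * sin t * \<tau>)) * D"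
    using Dpos unfolding strip_quantity_def dbl
    by (simp add: k_def[symmetric] c_def[symmetric] \<tau>_c D_def field_simps)
  finally show ?thesis
    using Dpos by (simp add: zero_le_mult_iff k_def \<tau>_def)
qed

text \<open>On the imaginary axis the quantity decreases up to \<open>t = \<pi>/2\<close>, the value on the right. In
its derivative, bounding \<open>tan (a t / 2)\<close> by \<open>a tan (t / 2)\<close> where it occurs linearly, and by
\<open>tan (t / 2)\<close> where it occurs squared, gives at most \<open>(a\<^sup>2 - 1) sin t\<close>.\<close>

lemma imaginary_axis_ge_boundary_value:
  assumes "0 < a" "a \<le> 1" "0 \<le> t" "t \<le> pi / 2"
  shows "cos t + a * sin t * tan (a * t / 2) \<ge> a * tan (a * pi / 4)"
proof -
  define g where "g t = cos t + a * sin t * tan (a * t / 2)" for t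
  have "g (pi / 2) \<le> g t"
  proof (rule DERIV_nonpos_imp_nonincreasing[OF assms(4)])
    fix y assume "t \<le> y" "y \<le> pi / 2"
    then have y: "0 \<le> y" "y \<le> pi / 2" using assms by auto
    have y_pi: "y < pi" using y pi_gt_zero by linarith
    define T where "T = tan (y / 2)"
    define \<tau> where "\<tau> = tan (a * y / 2)"
    have ay: "0 \<le> a * y" "a * y \<le> y" using y assms by (auto simp: mult_left_le_one_le)
    have ay_pi: "a * y < pi" using ay y pi_gt_zero by linarith
    have pos: "cos (a * y / 2) > 0" using y ay ay_pi by (auto intro!: cos_gt_zero_pi)
    have nonneg: "cos y \<ge> 0" "sin y \<ge> 0" using y by (auto intro!: cos_ge_zero sin_ge_zero)
    have \<tau>0: "\<tau> \<ge> 0"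
      unfolding \<tau>_def using ay ay_pi y by (intro tan_pos_pi2_le) auto
    have \<tau>T: "\<tau> \<le> a * T"
      using tan_mult_le[of a "y / 2"] assms y y_pi by (simp add: \<tau>_def T_def)
    then have \<tau>2: "\<tau>\<^sup>2 \<le> T\<^sup>2"
    proof -
      have "0 \<le> a * T" using \<tau>0 \<tau>T by linarith
      then have "0 \<le> T" using assms(1) by (simp add: zero_le_mult_iff)
      then have "a * T \<le> T" using assms by (intro mult_left_le_one_le) auto
      then show ?thesis using \<tau>0 \<tau>T by (intro power_mono) auto
    qed
    have T: "T * (1 + cos y) = sin y" "T\<^sup>2 * (1 + cos y) = 1 - cos y"
      unfolding T_def using y y_pi by (auto intro!: tan_half_mult_one_plus_cos)
    have sec: "inverse ((cos (a * y / 2))\<^sup>2) = 1 + \<tau>\<^sup>2"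
      unfolding \<tau>_def using pos tan_sec[of "a * y / 2"] by (simp add: power_inverse)
    define d where "d = - sin y + a * (cos y * \<tau>) + a * (sin y * (inverse ((cos (a * y / 2))\<^sup>2) * (a / 2)))"
    have "(g has_real_derivative d) (at y)"
      unfolding g_def d_def \<tau>_def using pos
      by (auto intro!: derivative_eq_intros simp: algebra_simps)
    moreover have "d \<le> 0"
    proof -
      have 1: "a * (cos y * \<tau>) \<le> a * (cos y * (a * T))"
        using \<tau>T nonneg assms by (intro mult_left_mono) auto
      have 2: "a * (sin y * ((1 + \<tau>\<^sup>2) * (a / 2))) \<le> a * (sin y * ((1 + T\<^sup>2) * (a / 2)))"
        using \<tau>2 nonneg assms by (intro mult_left_mono mult_right_mono) auto
      have "sin y * (1 + T\<^sup>2) = T * ((1 + cos y) + T\<^sup>2 * (1 + cos y))"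
        unfolding T(1)[symmetric] by (simp add: algebra_simps)
      then have 3: "sin y * (1 + T\<^sup>2) = 2 * T" unfolding T(2) by simp
      have "a * (cos y * (a * T)) + a * (sin y * ((1 + T\<^sup>2) * (a / 2))) = a\<^sup>2 * (cos y * T + sin y * (1 + T\<^sup>2) / 2)"
        by (simp add: algebra_simps power2_eq_square)
      also have "\<dots> = a\<^sup>2 * sin y" unfolding 3 by (simp add: T(1)[symmetric] algebra_simps)
      also have "\<dots> \<le> sin y" using nonneg assms by (intro mult_left_le_one_le) (auto simp: power_le_one)
      finally show ?thesis using 1 2 unfolding d_def sec by linarith
    qed
    ultimately show "\<exists>d. (g has_real_derivative d) (at y) \<and> d \<le> 0" by blast
  qed
  then show ?thesis by (simp add: g_def)
qed

text \<open>Both coordinates are moved to the extremal point: first \<open>s\<close> to \<open>0\<close>, then \<open>\<bar>t\<bar>\<close> to \<open>\<pi>/2\<close>.\<close>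

lemma strip_quantity_ge:
  assumes "0 < a" "a \<le> 1" "\<bar>t\<bar> < pi / 2"
  shows "strip_quantity a s t \<ge> a * tan (a * pi / 4)"
proof -
  have "a * tan (a * pi / 4) \<le> cos \<bar>t\<bar> + a * sin \<bar>t\<bar> * tan (a * \<bar>t\<bar> / 2)"
    using assms by (intro imaginary_axis_ge_boundary_value) auto
  also have "\<dots> \<le> strip_quantity a \<bar>s\<bar> \<bar>t\<bar>"
    using assms by (intro strip_quantity_ge_imaginary_axis) auto
  finally show ?thesis by (simp flip: strip_quantity_abs)
qed

section \<open>The disc as a strip\<close>

text \<open>The conformal map \<open>\<zeta> \<mapsto> tanh (\<zeta> / 2)\<close> takes the strip \<open>\<bar>Im \<zeta>\<bar> < \<pi>/2\<close> onto the unit disc. Multiplying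
numerator and denominator of \<open>tanh (\<zeta> / 2)\<close> by \<open>2 exp (\<zeta> / 2)\<close> shows it to be the Moebius image
of \<open>exp \<zeta>\<close>, the form in which it appears in the lens map.\<close>

lemma exp_pm_one_eq_half:
  fixes \<zeta> :: complex
  shows "exp \<zeta> + 1 = 2 * exp (\<zeta> / 2) * cosh (\<zeta> / 2)"
    and "exp \<zeta> - 1 = 2 * exp (\<zeta> / 2) * sinh (\<zeta> / 2)"
proof -
  have "exp \<zeta> = exp (\<zeta> / 2) * exp (\<zeta> / 2)" by (simp flip: exp_add)
  then show "exp \<zeta> + 1 = 2 * exp (\<zeta> / 2) * cosh (\<zeta> / 2)"
    "exp \<zeta> - 1 = 2 * exp (\<zeta> / 2) * sinh (\<zeta> / 2)"
    by (simp_all add: cosh_field_def sinh_field_def exp_minus distrib_left right_diff_distrib)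
qed

lemma tanh_half_eq:
  fixes \<zeta> :: complex
  shows "tanh (\<zeta> / 2) = (exp \<zeta> - 1) / (exp \<zeta> + 1)"
  unfolding exp_pm_one_eq_half tanh_def by simp

lemma exp_plus_one_nonzero:
  assumes "\<bar>Im \<zeta>\<bar> < pi"
  shows "exp \<zeta> + 1 \<noteq> 0"
proof
  assume "exp \<zeta> + 1 = 0"
  then have "exp \<zeta> = - 1" by (simp add: eq_neg_iff_add_eq_0)
  moreover have "ln (exp \<zeta>) = \<zeta>" using assms by (intro Ln_exp) auto
  ultimately have "Im \<zeta> = pi" by auto
  then show False using assms by simp
qed

lemma cosh_plus_cos_pos:
  fixes x y :: real
  assumes "\<bar>y\<bar> < pi"
  shows "cosh x + cos y > 0"
proof -
  have "cos y > - 1"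
    using cos_monotone_0_pi[of "\<bar>y\<bar>" pi] assms by simp
  then show ?thesis using cosh_real_ge_1[of x] by linarith
qed

text \<open>These formulas turn geometric conditions on \<open>tanh (\<zeta> / 2)\<close> into trigonometric conditions on
\<open>Im \<zeta>\<close>: the unit disc corresponds to \<open>cos (Im \<zeta>) > 0\<close>, and a disc with centre on the imaginary axis
whose boundary passes through \<open>1\<close> and \<open>-1\<close> to a comparison of \<open>sin (Im \<zeta>)\<close> with \<open>cos (Im \<zeta>)\<close>.\<close>

lemma tanh_half_parts:
  assumes "\<bar>Im \<zeta>\<bar> < pi"
  shows "Re (tanh (\<zeta> / 2)) = sinh (Re \<zeta>) / (cosh (Re \<zeta>) + cos (Im \<zeta>))"
    and "Im (tanh (\<zeta> / 2)) = sin (Im \<zeta>) / (cosh (Re \<zeta>) + cos (Im \<zeta>))"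
    and "(cmod (tanh (\<zeta> / 2)))\<^sup>2 = (cosh (Re \<zeta>) - cos (Im \<zeta>)) / (cosh (Re \<zeta>) + cos (Im \<zeta>))"
proof -
  define x where "x = Re \<zeta>"
  define y where "y = Im \<zeta>"
  define D where "D = cosh x + cos y"
  have D: "D > 0" using cosh_plus_cos_pos assms by (simp add: D_def x_def y_def)
  have "(exp \<zeta> - 1) * of_real D = Complex (sinh x) (sin y) * (exp \<zeta> + 1)"
    by (simp add: complex_eq_iff Re_exp Im_exp D_def sinh_field_def cosh_field_def x_def[symmetric]
        y_def[symmetric] exp_minus field_simps) 
      (use sin_cos_squared_add[of y] in algebra)
  then have eq: "tanh (\<zeta> / 2) = Complex (sinh x) (sin y) / of_real D"
    using D exp_plus_one_nonzero[OF assms] unfolding tanh_half_eq by (simp add: field_simps)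
  show "Re (tanh (\<zeta> / 2)) = sinh (Re \<zeta>) / (cosh (Re \<zeta>) + cos (Im \<zeta>))"
    "Im (tanh (\<zeta> / 2)) = sin (Im \<zeta>) / (cosh (Re \<zeta>) + cos (Im \<zeta>))"
    unfolding eq by (simp_all add: D_def x_def y_def)
  have "(cmod (tanh (\<zeta> / 2)))\<^sup>2 = ((sinh x)\<^sup>2 + (sin y)\<^sup>2) / D\<^sup>2"
    unfolding eq by (simp add: norm_divide power_divide cmod_power2)
  also have "(sinh x)\<^sup>2 + (sin y)\<^sup>2 = (cosh x - cos y) * D"
    using cosh_square_eq[of x] sin_squared_eq[of y] unfolding D_def by algebra
  finally show "(cmod (tanh (\<zeta> / 2)))\<^sup>2 = (cosh (Re \<zeta>) - cos (Im \<zeta>)) / (cosh (Re \<zeta>) + cos (Im \<zeta>))"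
    using D by (simp add: power2_eq_square D_def x_def y_def)
qed

definition disc_log :: "complex \<Rightarrow> complex" where
  "disc_log z = Ln ((1 + z) / (1 - z))"

lemma Re_moebius_pos:
  assumes "z \<in> unit_disc"
  shows "Re ((1 + z) / (1 - z)) > 0"
proof -
  have n: "cmod z < 1" using assms by simp
  have "z \<noteq> 1" using n by auto
  have "(Re z)\<^sup>2 + (Im z)\<^sup>2 < 1"
    using n by (simp flip: cmod_power2 add: power_less_one_iff)
  moreover have "Re ((1 + z) / (1 - z)) = (1 - ((Re z)\<^sup>2 + (Im z)\<^sup>2)) / (cmod (1 - z))\<^sup>2"
    by (simp add: Re_divide cmod_power2 field_simps) (simp add: algebra_simps power2_eq_square)
  ultimately show ?thesis using \<open>z \<noteq> 1\<close> by simp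
qed

lemma disc_log_Im: "z \<in> unit_disc \<Longrightarrow> \<bar>Im (disc_log z)\<bar> < pi / 2"
  unfolding disc_log_def by (metis Re_Ln_pos_lt Re_moebius_pos complex.sel(1) less_irrefl zero_complex.simps(1))

lemma exp_disc_log: "z \<in> unit_disc \<Longrightarrow> exp (disc_log z) = (1 + z) / (1 - z)"
  unfolding disc_log_def using Re_moebius_pos by (metis exp_Ln less_irrefl zero_complex.simps(1))

lemma tanh_disc_log:
  assumes "z \<in> unit_disc"
  shows "tanh (disc_log z / 2) = z"
proof -
  have "1 - z \<noteq> 0" using assms by auto
  then show ?thesis unfolding tanh_half_eq exp_disc_log[OF assms] by (simp add: field_simps)
qed

lemma tanh_half_in_disc:
  assumes "\<bar>Im \<zeta>\<bar> < pi / 2"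
  shows "tanh (\<zeta> / 2) \<in> unit_disc"
proof -
  have "cos (Im \<zeta>) > 0" using assms by (intro cos_gt_zero_pi) auto
  then have "(cmod (tanh (\<zeta> / 2)))\<^sup>2 < 1\<^sup>2"
    using cosh_plus_cos_pos[of "Im \<zeta>" "Re \<zeta>"] assms tanh_half_parts(3)[of \<zeta>] by simp
  then have "cmod (tanh (\<zeta> / 2)) < 1" by (rule power_less_imp_less_base) simp
  then show ?thesis by simp
qed

lemma disc_log_tanh:
  assumes "\<bar>Im \<zeta>\<bar> < pi / 2"
  shows "disc_log (tanh (\<zeta> / 2)) = \<zeta>"
proof -
  have nz: "exp \<zeta> + 1 \<noteq> 0" using exp_plus_one_nonzero assms by simp
  have "1 + tanh (\<zeta> / 2) = 2 * exp \<zeta> / (exp \<zeta> + 1)" "1 - tanh (\<zeta> / 2) = 2 / (exp \<zeta> + 1)"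
    unfolding tanh_half_eq using nz by (simp_all add: field_simps)
  then have "(1 + tanh (\<zeta> / 2)) / (1 - tanh (\<zeta> / 2)) = exp \<zeta>"
    using nz by simp
  then show ?thesis
    unfolding disc_log_def using assms by (simp add: Ln_exp abs_less_iff)
qed

text \<open>In the strip coordinate the lens map is multiplication by \<open>a\<close>.\<close>

lemma lens_map_eq_tanh:
  assumes "z \<in> unit_disc"
  shows "lens_map a z = tanh (of_real a * disc_log z / 2)"
proof -
  have "(1 + z) / (1 - z) \<noteq> 0" using Re_moebius_pos[OF assms] by (metis less_irrefl zero_complex.simps(1))
  then show ?thesis
    unfolding lens_map_def tanh_half_eq disc_log_def by (simp add: powr_def)
qed

lemma disc_log_has_derivative:
  assumes "z \<in> unit_disc"
  shows "(disc_log has_field_derivative 2 / (1 - z\<^sup>2)) (at z)"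
proof -
  have nz: "1 - z \<noteq> 0" "1 + z \<noteq> 0" using assms by (auto simp: add_eq_0_iff)
  have "(1 + z) / (1 - z) \<notin> \<real>\<^sub>\<le>\<^sub>0"
    using Re_moebius_pos[OF assms] complex_nonpos_Reals_iff[of "(1 + z) / (1 - z)"] by simp
  moreover have "((\<lambda>z. (1 + z) / (1 - z)) has_field_derivative 2 / ((1 - z) * (1 - z))) (at z)"
    using nz by (auto intro!: derivative_eq_intros)
  ultimately have "(disc_log has_field_derivative
      inverse ((1 + z) / (1 - z)) * (2 / ((1 - z) * (1 - z)))) (at z)"
    unfolding disc_log_def by (intro DERIV_chain2[OF has_field_derivative_Ln])
  also have "inverse ((1 + z) / (1 - z)) * (2 / ((1 - z) * (1 - z))) = 2 / ((1 - z) * (1 + z))"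
  proof -
    have "inverse (u / v) * (2 / (v * v)) = 2 / (v * u)" if "u \<noteq> 0" "v \<noteq> 0" for u v :: complex
      using that by (simp add: divide_simps)
    then show ?thesis using nz by blast
  qed
  also have "(1 - z) * (1 + z) = 1 - z\<^sup>2" by (simp add: power2_eq_square algebra_simps)
  finally show ?thesis .
qed

section \<open>Derivatives of the lens map\<close>

lemma scaled_disc_log_Im:
  assumes "0 < a" "z \<in> unit_disc"
  shows "\<bar>Im (of_real a * disc_log z)\<bar> < pi / 2 * a"
  using disc_log_Im[OF assms(2)] assms(1) by (simp add: abs_mult mult.commute)

lemma scaled_disc_log_Im_half_pi:
  assumes "0 < a" "a \<le> 1" "z \<in> unit_disc"
  shows "\<bar>Im (of_real a * disc_log z)\<bar> < pi / 2"
proof -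
  have "pi / 2 * a \<le> pi / 2" using assms(2) by simp
  then show ?thesis using scaled_disc_log_Im[OF assms(1,3)] by linarith
qed

lemma lens_map_in_disc:
  assumes "0 < a" "a \<le> 1" "z \<in> unit_disc"
  shows "lens_map a z \<in> unit_disc"
  unfolding lens_map_eq_tanh[OF assms(3)]
  using assms by (intro tanh_half_in_disc scaled_disc_log_Im_half_pi)

lemma one_minus_square_nonzero:
  fixes z :: complex
  assumes "z \<in> unit_disc"
  shows "1 - z\<^sup>2 \<noteq> 0"
  using assms by (auto simp: power2_eq_1_iff)

text \<open>The factor \<open>1 - (lens_map a z)\<^sup>2\<close> comes from \<open>tanh' = 1 - tanh\<^sup>2\<close>. A derivative that is algebraic in
\<open>z\<close> and the lens map itself makes the second derivative immediate.\<close>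

lemma lens_map_has_derivative:
  assumes "0 < a" "a \<le> 1" "z \<in> unit_disc"
  shows "(lens_map a has_field_derivative of_real a * (1 - (lens_map a z)\<^sup>2) / (1 - z\<^sup>2)) (at z)"
proof -
  let ?h = "\<lambda>z. tanh (of_real a * disc_log z / 2)"
  have "cosh (of_real a * disc_log z / 2) \<noteq> 0"
    using exp_plus_one_nonzero[of "of_real a * disc_log z"] exp_pm_one_eq_half(1)[of "of_real a * disc_log z"]
      scaled_disc_log_Im_half_pi[OF assms] by auto
  then have tanh: "(tanh has_field_derivative 1 - (?h z)\<^sup>2) (at (of_real a * disc_log z / 2))"
    by (auto intro!: derivative_eq_intros)
  have half: "of_real a * (2 / q) / 2 = of_real a / q" for q :: complex by simp
  have "((\<lambda>z. of_real a * disc_log z / 2) has_field_derivative of_real a / (1 - z\<^sup>2)) (at z)"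
    by (subst half[symmetric], intro DERIV_cdivide DERIV_cmult disc_log_has_derivative assms)
  from DERIV_chain2[OF tanh this]
  have "(?h has_field_derivative of_real a * (1 - (?h z)\<^sup>2) / (1 - z\<^sup>2)) (at z)"
    by (simp add: mult.commute)
  then show ?thesis
    unfolding lens_map_eq_tanh[OF assms(3)]
    by (rule has_field_derivative_transform_within_open[OF _ open_ball assms(3)])
       (simp add: lens_map_eq_tanh)
qed

lemma deriv_lens_map:
  assumes "0 < a" "a \<le> 1" "z \<in> unit_disc"
  shows "deriv (lens_map a) z = of_real a * (1 - (lens_map a z)\<^sup>2) / (1 - z\<^sup>2)"
  using lens_map_has_derivative[OF assms] by (rule DERIV_imp_deriv)

lemma deriv_lens_map_nonzero:
  assumes "0 < a" "a \<le> 1" "z \<in> unit_disc"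
  shows "deriv (lens_map a) z \<noteq> 0"
  using assms one_minus_square_nonzero[OF lens_map_in_disc[OF assms]]
    one_minus_square_nonzero[OF assms(3)]
  by (simp add: deriv_lens_map)

lemma pre_schwarzian_lens_map:
  assumes "0 < a" "a \<le> 1" "z \<in> unit_disc"
  shows "deriv (deriv (lens_map a)) z / deriv (lens_map a) z
    = (2 * z - 2 * of_real a * lens_map a z) / (1 - z\<^sup>2)"
proof -
  define f where "f = lens_map a z"
  have nz: "1 - z\<^sup>2 \<noteq> 0" "1 - f\<^sup>2 \<noteq> 0" "of_real a \<noteq> (0 :: complex)"
    using one_minus_square_nonzero lens_map_in_disc assms by (auto simp: f_def)
  define d where "d = of_real a * (1 - f\<^sup>2) / (1 - z\<^sup>2)"
  have "((\<lambda>z. of_real a * (1 - (lens_map a z)\<^sup>2) / (1 - z\<^sup>2)) has_field_derivative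
      (of_real a * (- (2 * f * d)) * (1 - z\<^sup>2) - of_real a * (1 - f\<^sup>2) * (- (2 * z))) / ((1 - z\<^sup>2) * (1 - z\<^sup>2))) (at z)"
    using nz unfolding d_def f_def
    by (auto intro!: derivative_eq_intros lens_map_has_derivative[OF assms])
  then have "(deriv (lens_map a) has_field_derivative
      (of_real a * (- (2 * f * d)) * (1 - z\<^sup>2) - of_real a * (1 - f\<^sup>2) * (- (2 * z))) / ((1 - z\<^sup>2) * (1 - z\<^sup>2))) (at z)"
    by (rule has_field_derivative_transform_within_open[OF _ open_ball assms(3)])
       (simp add: deriv_lens_map assms)
  then have "deriv (deriv (lens_map a)) z =
      (of_real a * (- (2 * f * d)) * (1 - z\<^sup>2) - of_real a * (1 - f\<^sup>2) * (- (2 * z))) / ((1 - z\<^sup>2) * (1 - z\<^sup>2))"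
    by (rule DERIV_imp_deriv)
  also have "\<dots> = d * ((2 * z - 2 * of_real a * f) / (1 - z\<^sup>2))"
    using nz unfolding d_def by (simp add: divide_simps) (simp add: algebra_simps)
  finally show ?thesis
    using deriv_lens_map_nonzero[OF assms] unfolding deriv_lens_map[OF assms] f_def[symmetric] d_def[symmetric]
    by simp
qed

text \<open>Since \<open>exp (disc_log z) = (1 + z) / (1 - z)\<close>, the rational functions \<open>(1 + z\<^sup>2) / (1 - z\<^sup>2)\<close> and
\<open>2 z / (1 - z\<^sup>2)\<close> that arise from the logarithmic derivative are \<open>cosh\<close> and \<open>sinh\<close> of \<open>disc_log z\<close>.\<close>

lemma convexity_quantity_lens_map:
  assumes "0 < a" "a \<le> 1" "z \<in> unit_disc"
  shows "convexity_quantity (lens_map a) z = strip_quantity a (Re (disc_log z)) (Im (disc_log z))"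
proof -
  define \<zeta> where "\<zeta> = disc_log z"
  define s t where "s = Re \<zeta>" and "t = Im \<zeta>"
  have nz: "1 - z \<noteq> 0" "1 + z \<noteq> 0" "1 - z\<^sup>2 \<noteq> 0"
    using assms(3) one_minus_square_nonzero by (auto simp: add_eq_0_iff)
  have e: "exp \<zeta> = (1 + z) / (1 - z)" using exp_disc_log assms by (simp add: \<zeta>_def)
  have fac: "1 - z\<^sup>2 = (1 - z) * (1 + z)" by (simp add: power2_eq_square algebra_simps)
  have c: "cosh \<zeta> = (1 + z\<^sup>2) / (1 - z\<^sup>2)"
    unfolding cosh_field_def exp_minus e fac using nz by (simp add: divide_simps) (simp add: algebra_simps power2_eq_square)
  have s: "sinh \<zeta> = 2 * z / (1 - z\<^sup>2)"
    unfolding sinh_field_def exp_minus e fac using nz by (simp add: divide_simps) (simp add: algebra_simps power2_eq_square)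
  have "1 + z * (deriv (deriv (lens_map a)) z / deriv (lens_map a) z) = cosh \<zeta> - of_real a * sinh \<zeta> * lens_map a z"
    unfolding pre_schwarzian_lens_map[OF assms] c s using nz
    by (simp add: divide_simps) (simp add: algebra_simps power2_eq_square)
  also have "lens_map a z = tanh (of_real a * \<zeta> / 2)"
    using lens_map_eq_tanh assms by (simp add: \<zeta>_def)
  finally have q: "convexity_quantity (lens_map a) z = Re (cosh \<zeta> - of_real a * sinh \<zeta> * tanh (of_real a * \<zeta> / 2))"
    by (simp add: convexity_quantity_def)
  have im: "\<bar>Im (of_real a * \<zeta>)\<bar> < pi"
    using scaled_disc_log_Im_half_pi[OF assms] pi_gt_zero unfolding \<zeta>_def by linarith
  have parts: "Re (cosh \<zeta>) = cosh s * cos t"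
    "Re (sinh \<zeta>) = sinh s * cos t" "Im (sinh \<zeta>) = cosh s * sin t"
    by (simp_all add: cosh_field_def sinh_field_def Re_exp Im_exp s_def t_def field_simps)
  show ?thesis
    unfolding q strip_quantity_def using tanh_half_parts(1,2)[OF im] parts
    by (simp add: \<zeta>_def[symmetric] s_def[symmetric] t_def[symmetric] diff_divide_distrib right_diff_distrib mult.assoc)
qed

section \<open>The order of convexity\<close>

text \<open>The lower bound is not attained inside the disc for \<open>a < 1\<close>; it is the limit along the imaginary
radius as \<open>z \<rightarrow> \<i>\<close>, that is, along \<open>\<zeta> = \<i> t\<close> as \<open>t\<close> tends to \<open>\<pi>/2\<close>.\<close>

lemma convexity_order_lens_map:
  assumes "0 < a" "a \<le> 1"
  shows "convexity_order (lens_map a) = a * tan (a * pi / 4)"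
proof (rule antisym)
  let ?g = "\<lambda>t. cos t + a * sin t * tan (a * t / 2)"
  have lower: "a * tan (a * pi / 4) \<le> convexity_quantity (lens_map a) z" if "z \<in> unit_disc" for z
    using convexity_quantity_lens_map strip_quantity_ge disc_log_Im that assms by simp
  show "a * tan (a * pi / 4) \<le> convexity_order (lens_map a)"
    unfolding convexity_order_def by (rule cINF_greatest) (use lower in auto)
  have "convexity_order (lens_map a) \<le> ?g t" if t: "0 < t" "t < pi / 2" for t
  proof -
    define z where "z = tanh ((\<i> * of_real t) / 2)"
    have im: "\<bar>Im (\<i> * of_real t)\<bar> < pi / 2" using t by simp
    have z: "z \<in> unit_disc" "disc_log z = \<i> * of_real t"
      unfolding z_def using tanh_half_in_disc[OF im] disc_log_tanh[OF im] by auto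
    have "convexity_order (lens_map a) \<le> convexity_quantity (lens_map a) z"
      unfolding convexity_order_def
      by (rule cINF_lower[OF bdd_belowI2 z(1)]) (rule lower)
    also have "\<dots> = ?g t"
      using t convexity_quantity_lens_map[OF assms z(1)] strip_quantity_imaginary_axis[of a t] z(2) by simp
    finally show ?thesis .
  qed
  then have "\<forall>\<^sub>F t in at_left (pi / 2). convexity_order (lens_map a) \<le> ?g t"
    unfolding eventually_at_left[OF pi_half_gt_zero] by (intro exI[of _ 0]) auto
  moreover have "(?g \<longlongrightarrow> ?g (pi / 2)) (at_left (pi / 2))"
  proof -
    have "0 < a * (pi / 2)" "a * (pi / 2) \<le> pi / 2" using assms by auto
    then have "cos (a * (pi / 2) / 2) \<noteq> 0"
      by (intro less_imp_neq[symmetric] cos_gt_zero_pi) linarith+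
    then have "isCont ?g (pi / 2)" by (intro continuous_intros) auto
    then show ?thesis by (meson continuous_within filterlim_at_split isCont_def)
  qed
  ultimately have "convexity_order (lens_map a) \<le> ?g (pi / 2)"
    by (intro tendsto_lowerbound) auto
  then show "convexity_order (lens_map a) \<le> a * tan (a * pi / 4)" by simp
qed

section \<open>Univalence and convexity of the image\<close>

lemma lens_map_holomorphic:
  assumes "0 < a" "a \<le> 1"
  shows "lens_map a holomorphic_on unit_disc"
  unfolding holomorphic_on_open[OF open_ball] using lens_map_has_derivative[OF assms] by blast

lemma lens_map_inj:
  assumes "0 < a" "a \<le> 1"
  shows "inj_on (lens_map a) unit_disc"
proof (rule inj_on_inverseI)
  fix z assume z: "z \<in> unit_disc"
  show "tanh (disc_log (lens_map a z) / of_real a / 2) = z"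
    using z assms tanh_disc_log[OF z] disc_log_tanh[OF scaled_disc_log_Im_half_pi[OF assms z]]
    by (simp add: lens_map_eq_tanh)
qed

text \<open>The condition on the radius says that the circle passes through \<open>1\<close> and \<open>-1\<close>.\<close>

lemma mem_ball_imaginary_center_iff:
  fixes c r :: real
  assumes "r\<^sup>2 = 1 + c\<^sup>2" "r > 0"
  shows "w \<in> ball (\<i> * of_real c) r \<longleftrightarrow> (cmod w)\<^sup>2 - 2 * c * Im w < 1"
proof -
  have "w \<in> ball (\<i> * of_real c) r \<longleftrightarrow> (cmod (\<i> * of_real c - w))\<^sup>2 < r\<^sup>2"
    using assms(2) by (simp add: dist_norm power_mono_iff flip: not_le)
  also have "\<dots> \<longleftrightarrow> (cmod w)\<^sup>2 - 2 * c * Im w < 1"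
    unfolding assms(1) by (simp add: cmod_power2) (simp add: power2_eq_square algebra_simps)
  finally show ?thesis .
qed

text \<open>The image is the part of the plane bounded by two circular arcs through \<open>1\<close> and \<open>-1\<close>: in the strip
coordinate it is \<open>\<bar>Im \<eta>\<bar> < \<theta>\<close> with \<open>\<theta> = \<pi> a / 2\<close>, and each bounding line is mapped into a circle with
centre \<open>\<plusminus> \<i> cot \<theta>\<close> and radius \<open>1 / sin \<theta>\<close>. The two discs together impose the inequality
\<open>cot \<theta> sin \<bar>Im \<eta>\<bar> < cos \<bar>Im \<eta>\<bar>\<close>, which is \<open>sin (\<theta> - \<bar>Im \<eta>\<bar>) > 0\<close>.\<close>

lemma lens_map_image:
  assumes "0 < a" "a \<le> 1"
  defines "c \<equiv> cot (pi / 2 * a)" and "r \<equiv> 1 / sin (pi / 2 * a)"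
  shows "lens_map a ` unit_disc = ball (\<i> * of_real c) r \<inter> ball (\<i> * of_real (- c)) r"
proof -
  define \<theta> where "\<theta> = pi / 2 * a"
  have \<theta>: "0 < \<theta>" "\<theta> \<le> pi / 2"
    using assms mult_left_le[of a "pi / 2"] by (auto simp: \<theta>_def)
  have sin_pos: "sin \<theta> > 0" using \<theta> pi_gt_zero by (intro sin_gt_zero) linarith+
  have c0: "c \<ge> 0" unfolding c_def \<theta>_def[symmetric] cot_def using \<theta> sin_pos by (auto intro!: divide_nonneg_pos cos_ge_zero)
  have r: "r > 0" "r\<^sup>2 = 1 + c\<^sup>2"
    using sin_pos unfolding r_def c_def \<theta>_def[symmetric] cot_def
    by (simp_all add: power_divide cos_squared_eq diff_divide_distrib)
  have lens_iff: "w \<in> ball (\<i> * of_real c) r \<inter> ball (\<i> * of_real (- c)) r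
      \<longleftrightarrow> (cmod w)\<^sup>2 + 2 * c * \<bar>Im w\<bar> < 1" for w
  proof -
    have "c * \<bar>Im w\<bar> = max (c * Im w) (- (c * Im w))"
      using c0 by (simp add: max_mult_distrib_left abs_real_def max_def mult_le_0_iff zero_le_mult_iff)
    then show ?thesis
      using r mem_ball_imaginary_center_iff[of r c w] mem_ball_imaginary_center_iff[of r "- c" w]
      by auto
  qed
  have strip_iff: "tanh (\<eta> / 2) \<in> ball (\<i> * of_real c) r \<inter> ball (\<i> * of_real (- c)) r
      \<longleftrightarrow> \<bar>Im \<eta>\<bar> < \<theta>" if \<eta>: "\<bar>Im \<eta>\<bar> < pi / 2" for \<eta>
  proof -
    have pi: "\<bar>Im \<eta>\<bar> < pi" using \<eta> by simp
    define D where "D = cosh (Re \<eta>) + cos (Im \<eta>)"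
    have D: "D > 0" unfolding D_def by (rule cosh_plus_cos_pos[OF pi])
    have abs_sin: "\<bar>sin (Im \<eta>)\<bar> = sin \<bar>Im \<eta>\<bar>"
      using sin_ge_zero[of "\<bar>Im \<eta>\<bar>"] pi by (auto simp: abs_if split: if_splits)
    have "(cmod (tanh (\<eta> / 2)))\<^sup>2 + 2 * c * \<bar>Im (tanh (\<eta> / 2))\<bar>
        = (cosh (Re \<eta>) - cos (Im \<eta>) + 2 * c * sin \<bar>Im \<eta>\<bar>) / D"
      using D unfolding tanh_half_parts(2,3)[OF pi] abs_sin[symmetric] D_def[symmetric]
      by (simp add: abs_divide add_divide_distrib)
    also have "\<dots> < 1 \<longleftrightarrow> c * sin \<bar>Im \<eta>\<bar> < cos \<bar>Im \<eta>\<bar>"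
      using D by (simp add: D_def)
    also have "\<dots> \<longleftrightarrow> 0 < sin (\<theta> - \<bar>Im \<eta>\<bar>)"
      using sin_pos unfolding c_def \<theta>_def[symmetric] cot_def
      by (simp add: sin_diff field_simps)
    also have "\<dots> \<longleftrightarrow> \<bar>Im \<eta>\<bar> < \<theta>"
    proof
      show "0 < sin (\<theta> - \<bar>Im \<eta>\<bar>)" if "\<bar>Im \<eta>\<bar> < \<theta>"
        using that \<theta> pi_gt_zero by (intro sin_gt_zero) linarith+
      show "\<bar>Im \<eta>\<bar> < \<theta>" if "0 < sin (\<theta> - \<bar>Im \<eta>\<bar>)"
        using that sin_ge_zero[of "\<bar>Im \<eta>\<bar> - \<theta>"] \<theta> \<eta> sin_minus[of "\<theta> - \<bar>Im \<eta>\<bar>"]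
        by (cases "\<bar>Im \<eta>\<bar> < \<theta>") auto
    qed
    finally show ?thesis unfolding lens_iff .
  qed
  show ?thesis
  proof (intro equalityI subsetI)
    fix w assume "w \<in> lens_map a ` unit_disc"
    then obtain z where z: "z \<in> unit_disc" "w = tanh (of_real a * disc_log z / 2)"
      using lens_map_eq_tanh by auto
    then show "w \<in> ball (\<i> * of_real c) r \<inter> ball (\<i> * of_real (- c)) r"
      using strip_iff[OF scaled_disc_log_Im_half_pi[OF assms(1,2) z(1)]]
        scaled_disc_log_Im[OF assms(1) z(1)] by (simp add: \<theta>_def)
  next
    fix w assume w: "w \<in> ball (\<i> * of_real c) r \<inter> ball (\<i> * of_real (- c)) r"
    \<comment> \<open>The two discs meet inside the unit disc, so \<open>w\<close> has a strip coordinate.\<close>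
    have "2 * c * \<bar>Im w\<bar> \<ge> 0" using c0 by simp
    then have "(cmod w)\<^sup>2 < 1" using w unfolding lens_iff by linarith
    then have disc: "w \<in> unit_disc" by (simp add: abs_square_less_1)
    define \<zeta> where "\<zeta> = disc_log w / of_real a"
    have "\<bar>Im (disc_log w)\<bar> < \<theta>"
      using strip_iff[OF disc_log_Im[OF disc]] w tanh_disc_log[OF disc] by simp
    then have im: "\<bar>Im \<zeta>\<bar> < pi / 2"
      using assms(1) by (simp add: \<zeta>_def \<theta>_def abs_divide divide_simps)
    have "lens_map a (tanh (\<zeta> / 2)) = w"
      using lens_map_eq_tanh[OF tanh_half_in_disc[OF im]] disc_log_tanh[OF im] tanh_disc_log[OF disc] assms(1)
      by (simp add: \<zeta>_def)
    then show "w \<in> lens_map a ` unit_disc" using tanh_half_in_disc[OF im] by blast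
  qed
qed

theorem theorem2:
  fixes \<alpha> :: real
  assumes "0 < \<alpha>" and "\<alpha> \<le> 1"
  shows "convex_mapping (lens_map \<alpha>)
       \<and> analytically_convex (lens_map \<alpha>)
       \<and> convexity_order (lens_map \<alpha>) =
           \<alpha> * sin (pi / 2 * \<alpha>) / (1 + cos (pi / 2 * \<alpha>))"
proof (intro conjI)
  show "convex_mapping (lens_map \<alpha>)"
    unfolding convex_mapping_def lens_map_image[OF assms]
    using lens_map_holomorphic lens_map_inj assms by (simp add: convex_Int)
  have "\<alpha> * pi / 4 < pi / 2" using assms mult_left_le_one_le[of pi \<alpha>] pi_gt_zero by linarith
  then have "\<alpha> * tan (\<alpha> * pi / 4) > 0" using assms by (simp add: tan_gt_zero)
  then have "convexity_quantity (lens_map \<alpha>) z > 0" if "z \<in> unit_disc" for z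
    using convexity_quantity_lens_map[OF assms that]
      strip_quantity_ge[OF assms disc_log_Im[OF that]] by (metis less_le_trans)
  then show "analytically_convex (lens_map \<alpha>)"
    unfolding analytically_convex_def
    using lens_map_holomorphic deriv_lens_map_nonzero assms by blast
  have "tan (\<alpha> * pi / 4) = sin (pi / 2 * \<alpha>) / (1 + cos (pi / 2 * \<alpha>))"
    using tan_half[of "\<alpha> * pi / 4"] by (simp add: mult.commute add.commute)
  then show "convexity_order (lens_map \<alpha>) =
           \<alpha> * sin (pi / 2 * \<alpha>) / (1 + cos (pi / 2 * \<alpha>))"
    unfolding convexity_order_lens_map[OF assms] by simp
qed

end
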